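(* For all $n\ge1$, $$P_n^{\mathsf{ddes}}(-1)=\begin{cases}E_n,&\text{if } n\text{ is odd},\\ 0,&\text{if } n\text{ is even}.\end{cases}$$ Thus $P^{\mathsf{ddes}}(-1;x)=\tan(x)$ (as formal power series in $x$).
   Context: Let $\mathfrak{S}_n$ be the set of permutations $\pi=\pi_1\cdots\pi_n$ (one-line notation) of $[n]=\{1,\dots,n\}$. Use the convention $\pi_0=\pi_{n+1}=\infty$. A letter $\pi_i$ ($1\le i\le n$) of $\pi$ is a double descent if $\pi_{i-1}>\pi_i>\pi_{i+1}$; let $\mathsf{ddes}(\pi)$ be the number of double descents of $\pi$. Define $P_n^{\mathsf{ddes}}(t)=\sum_{\pi\in\mathfrak{S}_n}t^{\mathsf{ddes}(\pi)}$ and $P^{\mathsf{ddes}}(t;x)=\sum_{n=1}^\infty P_n^{\mathsf{ddes}}(t)\frac{x^n}{n!}$. The Euler numbers $E_n$ are defined by $\sum_{n=0}^\infty E_n\frac{x^n}{n!}=\sec(x)+\tan(x)$. *)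

theory Defs
  imports
    Complex_Main
    "HOL-Library.Extended_Nat"
    "HOL-Combinatorics.Multiset_Permutations"
    "HOL-Computational_Algebra.Polynomial"
    "HOL-Computational_Algebra.Formal_Power_Series"
begin

text \<open>
  Permutations of \<open>{1..n}\<close> are words in one-line notation, i.e. elements of
  \<open>permutations_of_set {1..n}\<close>. The word \<open>padded p\<close> is
  \<open>\<infinity>, p\<^sub>1, \<dots>, p\<^sub>n, \<infinity>\<close>, so that \<open>padded p ! i\<close> is the \<open>i\<close>-th letter (counted from 1),
  with the convention \<open>p\<^sub>0 = p\<^sub>n\<^sub>+\<^sub>1 = \<infinity>\<close>.
\<close>

definition padded :: "nat list \<Rightarrow> enat list" where
  "padded p = \<infinity> # map enat p @ [\<infinity>]"

definition double_descent :: "nat list \<Rightarrow> nat \<Rightarrow> bool" where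
  "double_descent p i \<longleftrightarrow>
     padded p ! (i - 1) > padded p ! i \<and> padded p ! i > padded p ! (i + 1)"

definition ddes :: "nat list \<Rightarrow> nat" where
  "ddes p = card {i \<in> {1..length p}. double_descent p i}"

definition ddes_poly :: "nat \<Rightarrow> real poly" where
  "ddes_poly n = (\<Sum>p\<in>permutations_of_set {1..n}. monom 1 (ddes p))"

text \<open>The series in \<open>x\<close> for a fixed value of \<open>t\<close>; the summation starts at \<open>n = 1\<close>.\<close>

definition ddes_egf :: "real \<Rightarrow> real fps" where
  "ddes_egf t = Abs_fps (\<lambda>n. if n = 0 then 0 else poly (ddes_poly n) t / fact n)"

definition euler_number :: "nat \<Rightarrow> real" where
  "euler_number n = fact n * fps_nth (inverse (fps_cos 1) + fps_tan 1) n"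

lemma euler_number_egf:
  "Abs_fps (\<lambda>n. euler_number n / fact n) = inverse (fps_cos 1) + fps_tan 1"
  by (rule fps_ext) (simp add: euler_number_def)

end

theory Submission imports Defs begin

unbundle fps_syntax

text \<open>
  Splitting a nonempty permutation at its largest letter, \<open>\<pi> = \<sigma> n \<tau>\<close>, both \<open>\<sigma>\<close> and \<open>\<tau>\<close>
  are surrounded by larger letters, exactly as with the convention
  \<open>\<pi>\<^sub>0 = \<pi>\<^sub>n\<^sub>+\<^sub>1 = \<infinity>\<close>, and the letter \<open>n\<close> is a double descent iff \<open>\<sigma>\<close> is empty and
  \<open>\<tau>\<close> is not. Hence the exponential generating function \<open>F\<close> of the double descent polynomials
  satisfies \<open>F' = (1 + F)\<^sup>2 + (t - 1) F\<close>. At \<open>t = -1\<close> this is \<open>F' = 1 + F\<^sup>2\<close> with \<open>F(0) = 0\<close>,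
  whose only solution is the tangent. The case distinction follows because the tangent is odd and
  the secant is even.
\<close>

section \<open>Double descents and the largest letter\<close>

text \<open>The argument \<open>a\<close> is the left neighbour of the word. A last letter counts 0
  because its right neighbour is infinite.\<close>

fun ddes_from :: "enat \<Rightarrow> nat list \<Rightarrow> nat" where
  "ddes_from a [] = 0"
| "ddes_from a [x] = 0"
| "ddes_from a (x # y # xs) = of_bool (enat x < a \<and> y < x) + ddes_from (enat x) (y # xs)"

lemma ddes_from_eq_sum:
  fixes a :: enat and p :: "nat list"
  defines "L \<equiv> a # map enat p @ [\<infinity>]"
  shows "ddes_from a p =
    (\<Sum>i<length p. of_bool (L ! i > L ! Suc i \<and> L ! Suc i > L ! Suc (Suc i)))"
  unfolding L_def
  by (induction a p rule: ddes_from.induct)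
    (simp_all add: sum.lessThan_Suc_shift del: sum.lessThan_Suc)

lemma ddes_eq_ddes_from: "ddes p = ddes_from \<infinity> p"
proof -
  have "ddes p = (\<Sum>i\<in>{1..length p}. of_bool (double_descent p i))"
    by (simp add: ddes_def Int_def)
  also have "\<dots> = (\<Sum>i<length p. of_bool (double_descent p (Suc i)))"
    by (rule sum.reindex_bij_witness[of _ Suc "\<lambda>i. i - 1"]) auto
  finally show ?thesis
    by (simp add: ddes_from_eq_sum double_descent_def padded_def)
qed

text \<open>The induction replaces \<open>a\<close> by each letter of \<open>xs\<close> in turn, so
  \<open>a\<close> must be arbitrary; the condition \<open>enat m < a\<close> becomes trivial at
  \<open>a = \<infinity>\<close>.\<close>

lemma ddes_from_append_Max:
  assumes "\<forall>x\<in>set xs. x < m" "\<forall>y\<in>set ys. y < m"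
  shows "ddes_from a (xs @ m # ys) =
    ddes_from a xs + ddes_from \<infinity> ys + of_bool (xs = [] \<and> ys \<noteq> [] \<and> enat m < a)"
  using assms
proof (induction a xs rule: ddes_from.induct)
  case (1 a)
  \<comment> \<open>The first letter of \<open>ys\<close> lies below \<open>m\<close>, so
    \<open>m\<close> acts on it like infinity. The case rule separates words of length 0, 1 and at
    least 2.\<close>
  have "ddes_from (enat m) ys = ddes_from \<infinity> ys"
    using 1 by (cases ys rule: remdups_adj.cases) auto
  then show ?case
    using 1 by (cases ys) auto
next
  case (2 a x)
  have "ddes_from (enat m) ys = ddes_from \<infinity> ys"
    using 2 by (cases ys rule: remdups_adj.cases) auto
  then show ?case
    using 2 by (cases ys) auto
qed auto

lemma ddes_append_Max:
  assumes "\<forall>x\<in>set xs. x < m" "\<forall>y\<in>set ys. y < m"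
  shows "ddes (xs @ m # ys) = ddes xs + ddes ys + of_bool (xs = [] \<and> ys \<noteq> [])"
  using ddes_from_append_Max[OF assms, of \<infinity>] by (simp add: ddes_eq_ddes_from)

section \<open>The recurrence\<close>

text \<open>Cutting at \<open>m\<close> is a bijection: \<open>A\<close> is the set of letters
  before \<open>m\<close>, and both sides are ordered independently.\<close>

lemma sum_permutations_of_set_insert:
  fixes g :: "'a list \<Rightarrow> 'b::comm_monoid_add"
  assumes "finite S" "m \<notin> S"
  shows "(\<Sum>p\<in>permutations_of_set (insert m S). g p) =
    (\<Sum>A\<in>Pow S. \<Sum>xs\<in>permutations_of_set A. \<Sum>ys\<in>permutations_of_set (S - A).
       g (xs @ m # ys))"
proof -
  let ?D = "SIGMA A:Pow S. permutations_of_set A \<times> permutations_of_set (S - A)"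
  let ?f = "\<lambda>(A, xs, ys). xs @ m # ys"
  let ?h = "\<lambda>p. (set (takeWhile (\<lambda>x. x \<noteq> m) p), takeWhile (\<lambda>x. x \<noteq> m) p,
                 tl (dropWhile (\<lambda>x. x \<noteq> m) p))"
  have "(\<Sum>p\<in>permutations_of_set (insert m S). g p) = (\<Sum>d\<in>?D. g (?f d))"
  proof (rule sum.reindex_bij_witness[of _ ?f ?h])
    fix p assume p: "p \<in> permutations_of_set (insert m S)"
    then have "m \<in> set p" by (simp add: permutations_of_set_def)
    then obtain xs ys where eq: "p = xs @ m # ys" and m: "m \<notin> set xs"
      by (meson split_list_first)
    have [simp]: "takeWhile (\<lambda>x. x \<noteq> m) p = xs" "dropWhile (\<lambda>x. x \<noteq> m) p = m # ys"
      using m by (auto simp: eq takeWhile_append dropWhile_append)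
    show "?f (?h p) = p" by (simp add: eq[symmetric])
    have "distinct (xs @ m # ys)" "set (xs @ m # ys) = insert m S"
      using p by (auto simp: permutations_of_set_def eq)
    then show "?h p \<in> ?D"
      using assms(2) by (auto simp: permutations_of_set_def)
    show "g (?f (?h p)) = g p" using \<open>?f (?h p) = p\<close> by simp
  next
    fix d assume "d \<in> ?D"
    then obtain A xs ys where d: "d = (A, xs, ys)" and A: "A \<subseteq> S"
      and xs: "xs \<in> permutations_of_set A" and ys: "ys \<in> permutations_of_set (S - A)"
      by auto
    have m: "m \<notin> set xs"
      using xs A assms(2) by (auto simp: permutations_of_set_def)
    then have "takeWhile (\<lambda>x. x \<noteq> m) (xs @ m # ys) = xs"
      "dropWhile (\<lambda>x. x \<noteq> m) (xs @ m # ys) = m # ys"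
      by (auto simp: takeWhile_append dropWhile_append)
    then show "?h (?f d) = d"
      using xs by (simp add: d permutations_of_set_def)
    show "?f d \<in> permutations_of_set (insert m S)"
      using xs ys A assms(2) by (auto simp: d permutations_of_set_def)
  qed
  also have "\<dots> = (\<Sum>A\<in>Pow S. \<Sum>z\<in>permutations_of_set A \<times> permutations_of_set (S - A).
       g (fst z @ m # snd z))"
    using assms(1)
    by (subst sum.Sigma) (auto simp: case_prod_unfold intro: finite_subset)
  also have "\<dots> = (\<Sum>A\<in>Pow S. \<Sum>xs\<in>permutations_of_set A. \<Sum>ys\<in>permutations_of_set (S - A).
       g (xs @ m # ys))"
    by (simp add: sum.cartesian_product case_prod_unfold)
  finally show ?thesis .
qed

lemma sum_Pow_card:
  fixes g :: "nat \<Rightarrow> 'a::semiring_1"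
  assumes "finite S"
  shows "(\<Sum>A\<in>Pow S. g (card A)) = (\<Sum>k\<le>card S. of_nat (card S choose k) * g k)"
proof -
  have "(\<Sum>A\<in>Pow S. g (card A)) = (\<Sum>k\<le>card S. \<Sum>A\<in>{A\<in>Pow S. card A = k}. g (card A))"
    using assms by (intro sum.group[symmetric]) (auto intro: card_mono)
  also have "\<dots> = (\<Sum>k\<le>card S. of_nat (card S choose k) * g k)"
    using assms by (intro sum.cong) (simp_all add: n_subsets)
  finally show ?thesis .
qed

text \<open>The letter set is arbitrary because the words beside the maximum need not use an initial
  segment.\<close>

definition ddes_sum :: "real \<Rightarrow> nat set \<Rightarrow> real" where
  "ddes_sum t S = (\<Sum>p\<in>permutations_of_set S. t ^ ddes p)"

lemma poly_ddes_poly: "poly (ddes_poly n) t = ddes_sum t {1..n}"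
  by (simp add: ddes_poly_def ddes_sum_def poly_sum poly_monom)

lemma ddes_sum_insert_Max:
  assumes S: "finite S" and m: "\<forall>x\<in>S. x < m"
  shows "ddes_sum t (insert m S) =
    (\<Sum>A\<in>Pow S. (if A = {} \<and> S \<noteq> {} then t else 1) * ddes_sum t A * ddes_sum t (S - A))"
proof -
  have "ddes_sum t (insert m S) =
      (\<Sum>A\<in>Pow S. \<Sum>xs\<in>permutations_of_set A. \<Sum>ys\<in>permutations_of_set (S - A).
         t ^ ddes (xs @ m # ys))"
    unfolding ddes_sum_def using assms by (intro sum_permutations_of_set_insert) auto
  also have "\<dots> = (\<Sum>A\<in>Pow S. \<Sum>xs\<in>permutations_of_set A. \<Sum>ys\<in>permutations_of_set (S - A).
       (if A = {} \<and> S \<noteq> {} then t else 1) * t ^ ddes xs * t ^ ddes ys)"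
  proof (intro sum.cong refl)
    fix A xs ys
    assume A: "A \<in> Pow S" and "xs \<in> permutations_of_set A" "ys \<in> permutations_of_set (S - A)"
    then have sets: "set xs = A" "set ys = S - A"
      by (simp_all add: permutations_of_set_def)
    then have "ddes (xs @ m # ys) = ddes xs + ddes ys + of_bool (xs = [] \<and> ys \<noteq> [])"
      using m A by (intro ddes_append_Max) auto
    moreover have "(xs = [] \<and> ys \<noteq> []) \<longleftrightarrow> (A = {} \<and> S \<noteq> {})"
      using sets by (metis Diff_empty set_empty)
    ultimately show "t ^ ddes (xs @ m # ys) =
        (if A = {} \<and> S \<noteq> {} then t else 1) * t ^ ddes xs * t ^ ddes ys"
      by (auto simp: power_add)
  qed
  also have "\<dots> = (\<Sum>A\<in>Pow S. (if A = {} \<and> S \<noteq> {} then t else 1) *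
      ddes_sum t A * ddes_sum t (S - A))"
    unfolding ddes_sum_def mult.assoc sum_product by (simp only: sum_distrib_left)
  finally show ?thesis .
qed

text \<open>Dependence on cardinality alone is assumed only for subsets of \<open>S\<close>, so that
  this recurrence can be used within the induction that proves it in general.\<close>

lemma ddes_sum_rec:
  assumes S: "finite S" and m: "\<forall>x\<in>S. x < m"
    and f: "\<And>A. A \<subseteq> S \<Longrightarrow> ddes_sum t A = f (card A)"
  shows "ddes_sum t (insert m S) =
    (\<Sum>k\<le>card S. of_nat (card S choose k) *
       ((if k = 0 \<and> card S \<noteq> 0 then t else 1) * f k * f (card S - k)))"
proof -
  have "ddes_sum t (insert m S) =
    (\<Sum>A\<in>Pow S. (if A = {} \<and> S \<noteq> {} then t else 1) * ddes_sum t A * ddes_sum t (S - A))"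
    by (rule ddes_sum_insert_Max[OF S m])
  also have "\<dots> = (\<Sum>A\<in>Pow S. (if card A = 0 \<and> card S \<noteq> 0 then t else 1) *
      f (card A) * f (card S - card A))"
  proof (intro sum.cong refl)
    fix A assume "A \<in> Pow S"
    then have "finite A" "A \<subseteq> S" using S by (auto intro: finite_subset)
    then show "(if A = {} \<and> S \<noteq> {} then t else 1) * ddes_sum t A * ddes_sum t (S - A) =
        (if card A = 0 \<and> card S \<noteq> 0 then t else 1) * f (card A) * f (card S - card A)"
      using S f[of A] f[of "S - A"] by (simp add: card_Diff_subset)
  qed
  also have "\<dots> = (\<Sum>k\<le>card S. of_nat (card S choose k) *
       ((if k = 0 \<and> card S \<noteq> 0 then t else 1) * f k * f (card S - k)))"
    by (rule sum_Pow_card[OF S])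
  finally show ?thesis .
qed

text \<open>No relabelling of letters is constructed: by strong induction on size, the recurrences
  for \<open>S\<close> and for \<open>{1..card S}\<close> have equal terms.\<close>

lemma ddes_sum_card:
  assumes "finite S"
  shows "ddes_sum t S = ddes_sum t {1..card S}"
  using assms
proof (induction "card S" arbitrary: S rule: less_induct)
  case less
  show ?case
  proof (cases "S = {}")
    case False
    define R where "R = S - {Max S}"
    define n where "n = card R"
    have S: "S = insert (Max S) R" and R: "finite R" "\<forall>x\<in>R. x < Max S"
      using less.prems Max_in[OF less.prems False] unfolding R_def
      by (auto simp: order.strict_iff_order)
    have card: "card S = Suc n"
      using R unfolding n_def by (subst S, subst card_insert_disjoint) auto
    \<comment> \<open>Stated for any \<open>B\<close> of size \<open>n\<close>, to serve both
      \<open>R\<close> and \<open>{1..n}\<close>.\<close>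
    have IH: "ddes_sum t A = ddes_sum t {1..card A}" if "A \<subseteq> B" "finite B" "card B = n" for A B
      using that less.hyps[of A] card card_mono[of B A] finite_subset[of A B] by simp
    have "ddes_sum t S = ddes_sum t (insert (Max S) R)" using S by simp
    also have "\<dots> = ddes_sum t (insert (Suc n) {1..n})"
      using ddes_sum_rec[OF R(1,2) IH[OF _ R(1)]] ddes_sum_rec[of "{1..n}" "Suc n", OF _ _ IH]
      by (simp add: n_def)
    also have "insert (Suc n) {1..n} = {1..card S}" using card by auto
    finally show ?thesis .
  qed simp
qed

lemma ddes_sum_empty: "ddes_sum t {} = 1"
  by (simp add: ddes_sum_def ddes_def)

lemma ddes_sum_Suc:
  "ddes_sum t {1..Suc n} =
    (\<Sum>k\<le>n. of_nat (n choose k) * (ddes_sum t {1..k} * ddes_sum t {1..n - k})) +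
    (if n = 0 then 0 else (t - 1) * ddes_sum t {1..n})"
proof -
  have "{1..Suc n} = insert (Suc n) {1..n}" by auto
  then have "ddes_sum t {1..Suc n} = (\<Sum>k\<le>n. of_nat (n choose k) *
      ((if k = 0 \<and> n \<noteq> 0 then t else 1) * ddes_sum t {1..k} * ddes_sum t {1..n - k}))"
    using ddes_sum_rec[of "{1..n}" "Suc n" t "\<lambda>k. ddes_sum t {1..k}",
        OF _ _ ddes_sum_card[OF finite_subset]] by simp
  \<comment> \<open>The weight \<open>t\<close> at \<open>k = 0\<close> is split as
    \<open>1 + (t - 1)\<close>.\<close>
  also have "\<dots> = (\<Sum>k\<le>n. of_nat (n choose k) * (ddes_sum t {1..k} * ddes_sum t {1..n - k}) +
      (if k = 0 then (if n = 0 then 0 else (t - 1) * ddes_sum t {1..n}) else 0))"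
    by (intro sum.cong refl) (simp add: ddes_sum_empty left_diff_distrib)
  finally show ?thesis by (simp add: sum.distrib)
qed

section \<open>Formal power series\<close>

lemma ddes_egf_deriv:
  "fps_deriv (ddes_egf t) = (1 + ddes_egf t)\<^sup>2 + fps_const (t - 1) * ddes_egf t"
proof (rule fps_ext)
  fix n
  \<comment> \<open>Adding 1 restores the empty word, which the series omits.\<close>
  have nth: "(1 + ddes_egf t) $ k = ddes_sum t {1..k} / fact k" for k
    by (simp add: ddes_egf_def poly_ddes_poly ddes_sum_empty)
  have "fps_deriv (ddes_egf t) $ n = ddes_sum t {1..Suc n} / fact n"
    by (simp add: ddes_egf_def poly_ddes_poly del: of_nat_Suc)
  also have "\<dots> = (\<Sum>k\<le>n. of_nat (n choose k) *
        (ddes_sum t {1..k} * ddes_sum t {1..n - k}) / fact n) +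
      (if n = 0 then 0 else (t - 1) * ddes_sum t {1..n}) / fact n"
    unfolding ddes_sum_Suc by (simp add: add_divide_distrib sum_divide_distrib)
  also have "(\<Sum>k\<le>n. of_nat (n choose k) *
        (ddes_sum t {1..k} * ddes_sum t {1..n - k}) / fact n) = ((1 + ddes_egf t)\<^sup>2) $ n"
    unfolding power2_eq_square fps_mult_nth nth atLeast0AtMost
    by (intro sum.cong) (auto simp: binomial_fact)
  also have "(if n = 0 then 0 else (t - 1) * ddes_sum t {1..n}) / fact n =
      (fps_const (t - 1) * ddes_egf t) $ n"
    by (simp add: ddes_egf_def poly_ddes_poly)
  finally show "fps_deriv (ddes_egf t) $ n =
      ((1 + ddes_egf t)\<^sup>2 + fps_const (t - 1) * ddes_egf t) $ n"
    by simp
qed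

section \<open>Uniqueness for the differential equation of the tangent\<close>

lemma fps_linear_ode_zero:
  fixes H :: "'a::field_char_0 fps"
  assumes "fps_deriv H = A * H" "H $ 0 = 0"
  shows "H = 0"
proof -
  have "H $ n = 0" for n
  proof (induction n rule: less_induct)
    case (less n)
    show ?case
    proof (cases n)
      case (Suc k)
      \<comment> \<open>The coefficient on the right involves only \<open>H $ 0\<close> to
        \<open>H $ k\<close>, which vanish by induction.\<close>
      have "of_nat (Suc k) * H $ Suc k = (A * H) $ k"
        using assms(1) by (metis fps_deriv_nth Suc_eq_plus1)
      also have "\<dots> = 0"
        unfolding fps_mult_nth using less Suc by (intro sum.neutral) auto
      finally show ?thesis using Suc by (simp del: of_nat_Suc)
    qed (use assms in simp)
  qed
  then show ?thesis by (simp add: fps_eq_iff)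
qed

text \<open>The difference of two solutions \<open>F\<close> and \<open>T\<close> satisfies the
  linear equation \<open>(F - T)' = (F + T) * (F - T)\<close> with zero constant term.\<close>

lemma fps_tan_unique:
  fixes F :: "'a::field_char_0 fps"
  assumes "fps_deriv F = 1 + F\<^sup>2" "F $ 0 = 0"
  shows "F = fps_tan 1"
proof -
  have unit: "fps_cos (1::'a) $ 0 \<noteq> 0" by simp
  have "fps_cos (1::'a) * inverse (fps_cos 1) = 1"
    using inverse_mult_eq_1'[OF unit] by simp
  moreover have tan: "fps_tan (1::'a) = fps_sin 1 * inverse (fps_cos 1)"
    unfolding fps_tan_def by (rule fps_divide_unit[OF unit])
  moreover have "fps_deriv (fps_tan (1::'a)) = inverse (fps_cos 1) ^ 2"
    unfolding fps_tan_deriv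
    by (subst fps_divide_unit) (simp_all add: fps_inverse_power)
  moreover have "(fps_cos (1::'a))\<^sup>2 + (fps_sin 1)\<^sup>2 = 1"
    by (rule fps_sin_cos_sum_of_squares)
  ultimately have "fps_deriv (fps_tan (1::'a)) = 1 + (fps_tan 1)\<^sup>2"
    by algebra
  then have "fps_deriv (F - fps_tan 1) = (F + fps_tan 1) * (F - fps_tan 1)"
    using assms(1) by (simp add: algebra_simps power2_eq_square)
  moreover have "(F - fps_tan 1) $ 0 = 0"
    using assms(2) by (simp add: tan)
  ultimately have "F - fps_tan 1 = 0" by (rule fps_linear_ode_zero)
  then show ?thesis by simp
qed

section \<open>Parity of secant and tangent\<close>

lemma fps_nth_compose_uminus_X:
  "(F oo - fps_X) $ n = (-1) ^ n * (F $ n :: 'a::comm_ring_1)"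
  using fps_nth_compose_linear[of F "-1" n] by (simp flip: fps_const_neg)

text \<open>The cosine is invariant under substituting \<open>- fps_X\<close>, hence so is its
  inverse; an odd coefficient then equals its own negative.\<close>

lemma fps_sec_nth_odd:
  assumes "odd n"
  shows "inverse (fps_cos (1::'a::field_char_0)) $ n = 0"
proof -
  have "fps_cos 1 oo - fps_X = fps_cos (1::'a)"
    by (rule fps_ext) (simp add: fps_nth_compose_uminus_X fps_cos_def)
  then have "inverse (fps_cos (1::'a)) oo - fps_X = inverse (fps_cos 1)"
    by (subst fps_inverse_compose) auto
  then have "inverse (fps_cos (1::'a)) $ n = (-1) ^ n * inverse (fps_cos 1) $ n"
    by (metis fps_nth_compose_uminus_X)
  then show ?thesis using assms by simp
qed

lemma fps_tan_nth_even:
  assumes "even n"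
  shows "fps_tan (1::'a::field_char_0) $ n = 0"
proof -
  \<comment> \<open>As \<open>n\<close> is even, \<open>i\<close> and \<open>n - i\<close> have
    equal parity: the sine factor vanishes if \<open>i\<close> is even, the secant factor if it is
    odd.\<close>
  have "fps_sin (1::'a) $ i * inverse (fps_cos 1) $ (n - i) = 0" if "i \<le> n" for i
    using that assms fps_sec_nth_odd[of "n - i", where ?'a = 'a]
    by (cases "even i") (auto simp: fps_sin_def)
  then show ?thesis
    unfolding fps_tan_def by (subst fps_divide_unit) (simp_all add: fps_mult_nth sum.neutral)
qed

theorem theorem6:
  shows "(\<forall>n::nat. n \<ge> 1 \<longrightarrow>
            poly (ddes_poly n) (-1) = (if odd n then euler_number n else 0)) \<and>
         ddes_egf (-1) = fps_tan 1"
proof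
  \<comment> \<open>At \<open>t = -1\<close> the linear term \<open>-2 F\<close> cancels the cross
    term of \<open>(1 + F)^2\<close>.\<close>
  have "fps_deriv (ddes_egf (-1)) = 1 + (ddes_egf (-1))\<^sup>2"
    unfolding ddes_egf_deriv
    by (simp add: algebra_simps power2_eq_square flip: fps_const_neg numeral_fps_const)
  then show tan: "ddes_egf (-1) = fps_tan 1"
    by (rule fps_tan_unique) (simp add: ddes_egf_def)
  show "\<forall>n\<ge>1. poly (ddes_poly n) (-1) = (if odd n then euler_number n else 0)"
  proof (intro allI impI)
    fix n :: nat assume "n \<ge> 1"
    then have "poly (ddes_poly n) (-1) = fact n * fps_tan 1 $ n"
      unfolding tan[symmetric] by (simp add: ddes_egf_def)
    \<comment> \<open>For odd \<open>n\<close> only the tangent contributes to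
      \<open>euler_number n\<close>.\<close>
    then show "poly (ddes_poly n) (-1) = (if odd n then euler_number n else 0)"
      by (simp add: euler_number_def fps_sec_nth_odd fps_tan_nth_even)
  qed
qed

end
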